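(* For every integer $n \ge 0$, let $d_2^e(n)$ (respectively $d_2^o(n)$) be the number of overpartitions of $n$ in which only even parts may be overlined and which have an even (respectively odd) number of parts. For an integer $m$ let $\omega_m = m(3m+1)/2$. Then for all $n \ge 0$, $$d_2^e(n) - d_2^o(n) = \begin{cases} (-1)^m & \text{if } n = \omega_m \text{ for some integer } m,\\ 0 & \text{otherwise}.\end{cases}$$
   Context: An overpartition of $n$ is a partition of $n$ in which the first occurrence of each distinct part value may be overlined; equivalently a pair $(\mu,\nu)$ with $\mu$ a partition (non-overlined parts), $\nu$ a partition into distinct parts (overlined parts), $|\mu|+|\nu|=n$. Overpartitions "in which only even parts may be overlined" are those where all overlined parts are even. The number of parts (length) counts all parts, overlined or not; the empty partition of $0$ has length $0$. The integer $m$ ranges over all integers, including negative ones (the $\omega_m$ are the generalized pentagonal numbers, and for $n$ of this form $m$ is unique). *)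

theory Defs
  imports Main "HOL-Library.Multiset"
begin

definition partition_of :: "nat \<Rightarrow> nat multiset \<Rightarrow> bool" where
  "partition_of n \<mu> \<longleftrightarrow> 0 \<notin># \<mu> \<and> \<Sum>\<^sub># \<mu> = n"

definition distinct_parts :: "nat multiset \<Rightarrow> bool" where
  "distinct_parts \<nu> \<longleftrightarrow> (\<forall>k. count \<nu> k \<le> 1)"

text \<open>
  An overpartition is the pair of the multiset of its non-overlined parts and the multiset
  of its overlined parts. As only the first occurrence of a part value may be overlined,
  the overlined parts are pairwise distinct.
\<close>

type_synonym overpartition = "nat multiset \<times> nat multiset"

definition overpartitions :: "nat \<Rightarrow> overpartition set" where
  "overpartitions n = {(\<mu>, \<nu>). distinct_parts \<nu> \<and>
     (\<exists>a b. partition_of a \<mu> \<and> partition_of b \<nu> \<and> a + b = n)}"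

definition num_parts :: "overpartition \<Rightarrow> nat" where
  "num_parts \<pi> = size (fst \<pi>) + size (snd \<pi>)"

definition only_even_overlined :: "overpartition \<Rightarrow> bool" where
  "only_even_overlined \<pi> \<longleftrightarrow> (\<forall>k \<in># snd \<pi>. even k)"

definition d2e :: "nat \<Rightarrow> nat" where
  "d2e n = card {\<pi> \<in> overpartitions n. only_even_overlined \<pi> \<and> even (num_parts \<pi>)}"

definition d2o :: "nat \<Rightarrow> nat" where
  "d2o n = card {\<pi> \<in> overpartitions n. only_even_overlined \<pi> \<and> odd (num_parts \<pi>)}"

text \<open>The division is exact, since \<open>m * (3 * m + 1)\<close> is always even.\<close>

definition pent :: "int \<Rightarrow> int" where
  "pent m = m * (3 * m + 1) div 2"

lemma two_pent: "2 * pent m = m * (3 * m + 1)"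
  unfolding pent_def by simp

lemma size_le_sum_mset: "0 \<notin># \<mu> \<Longrightarrow> size \<mu> \<le> \<Sum>\<^sub># (\<mu> :: nat multiset)"
  by (induction \<mu>) auto

lemma finite_partition_of_le: "finite {\<mu>. \<exists>a\<le>n. partition_of a \<mu>}"
proof (rule finite_subset)
  show "{\<mu>. \<exists>a\<le>n. partition_of a \<mu>} \<subseteq> mset ` {xs. set xs \<subseteq> {..n} \<and> length xs \<le> n}"
  proof
    fix \<mu> assume "\<mu> \<in> {\<mu>. \<exists>a\<le>n. partition_of a \<mu>}"
    then have \<mu>: "0 \<notin># \<mu>" "\<Sum>\<^sub># \<mu> \<le> n" by (auto simp: partition_of_def)
    obtain xs where xs: "\<mu> = mset xs" by (metis ex_mset)
    have "set xs \<subseteq> {..n}"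
    proof
      fix x assume "x \<in> set xs"
      then have "x \<le> sum_list xs" by (simp add: member_le_sum_list)
      with \<mu>(2) show "x \<in> {..n}" by (simp add: xs sum_mset_sum_list)
    qed
    moreover have "length xs \<le> n" using size_le_sum_mset[OF \<mu>(1)] \<mu>(2) by (simp add: xs)
    ultimately show "\<mu> \<in> mset ` {xs. set xs \<subseteq> {..n} \<and> length xs \<le> n}" by (simp add: xs)
  qed
  show "finite (mset ` {xs. set xs \<subseteq> {..n} \<and> length xs \<le> n})"
    by (simp add: finite_lists_length_le)
qed

lemma finite_overpartitions: "finite (overpartitions n)"
proof (rule finite_subset)
  let ?P = "{\<mu>. \<exists>a\<le>n. partition_of a \<mu>}"
  show "overpartitions n \<subseteq> ?P \<times> ?P"
    by (auto simp: overpartitions_def intro: le_add1 le_add2)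
  show "finite (?P \<times> ?P)" using finite_partition_of_le by blast
qed

end

theory Submission
  imports Defs "HOL-Computational_Algebra.Formal_Power_Series"
begin

text \<open>
  Counting each overpartition with the sign given by its number of parts, the generating function is
  \<open>\<Prod>k. (1 - q\<^sup>2\<^sup>k) / (1 + q\<^sup>k) = \<Prod>k. (1 - q\<^sup>k)\<close>, so the claim is Euler's pentagonal
  number theorem. The latter follows from Shanks' finite identity
  \<open>\<Sum>k\<le>n. (-1)\<^sup>k (1 - q\<^sup>k\<^sup>+\<^sup>1) \<dots> (1 - q\<^sup>n) q\<^bsup>kn + k(k+1)/2\<^esup> = \<Sum>\<bar>m\<bar>\<le>n. (-1)\<^sup>m q\<^bsup>m(3m+1)/2\<^esup>\<close>,
  where all terms on the left with \<open>k > 0\<close> vanish modulo \<open>q\<^sup>n\<^sup>+\<^sup>1\<close>. Only the parts of size at most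
  \<open>n\<close> (and overlined parts of size at most \<open>2n\<close>) matter for the coefficient of \<open>q\<^sup>n\<close>, so all products
  can be kept finite.
\<close>

unbundle fps_syntax

section \<open>Generalized pentagonal numbers\<close>

text \<open>Ensures that at most one summand survives in the sum over \<open>m\<close> that gives
  the coefficient of the Euler product.\<close>

lemma inj_pent: "inj pent"
proof (rule injI)
  fix m k assume "pent m = pent k"
  then have "m * (3 * m + 1) = k * (3 * k + 1)"
    using two_pent[of m] two_pent[of k] by simp
  then have "(m - k) * (3 * (m + k) + 1) = 0"
    by (simp add: algebra_simps)
  \<comment> \<open>It is 1 modulo 3.\<close>
  moreover have "3 * (m + k) + 1 \<noteq> 0"
    by presburger
  ultimately show "m = k"
    by simp
qed

text \<open>Used twice: it confines every \<open>m\<close> with \<open>pent m = n\<close> to the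
  range from \<open>- n\<close> to \<open>n\<close>, and it makes \<open>pent m\<close> nonnegative,
  so that \<open>nat (pent m)\<close> loses nothing.\<close>

lemma abs_le_pent: "\<bar>m\<bar> \<le> pent m"
proof -
  have "2 * \<bar>m\<bar> \<le> m * (3 * m + 1)"
  proof (cases "m \<ge> 0")
    case True
    then have "m * (3 * m - 1) \<ge> 0"
      by (cases "m = 0") auto
    then show ?thesis
      using True by (simp add: algebra_simps)
  next
    case False
    \<comment> \<open>The difference of the two sides is \<open>3 * m * (m + 1)\<close>, three times
      this product.\<close>
    then have "(- m) * (- 1 - m) \<ge> 0"
      by (intro mult_nonneg_nonneg) auto
    then show ?thesis
      using False by (simp add: algebra_simps)
  qed
  then show ?thesis
    using two_pent[of m] by linarith
qed

text \<open>The right-hand side is the exponent in \<open>shanks_term q n n\<close>.\<close>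

lemma nat_pent_of_nat: "nat (pent (int n)) = n * n + (\<Sum>i\<le>n. i)"
proof -
  have "2 * (n * n + (\<Sum>i\<le>n. i)) = n * (3 * n + 1)"
    by (induction n) (auto simp: algebra_simps)
  then have "2 * int (n * n + (\<Sum>i\<le>n. i)) = int n * int (3 * n + 1)"
    by (metis of_nat_mult of_nat_numeral)
  also have "\<dots> = 2 * pent (int n)"
    unfolding two_pent by (simp add: algebra_simps)
  finally have "int (n * n + (\<Sum>i\<le>n. i)) = pent (int n)"
    by (simp only: mult_cancel_left) simp
  then show ?thesis
    by (metis nat_int)
qed

text \<open>The right-hand side is the exponent in the closed form of
  \<open>shanks_term_telescope\<close> at \<open>j = n\<close>.\<close>

lemma nat_pent_uminus_Suc: "nat (pent (- int (Suc n))) = Suc n * Suc n + (\<Sum>i\<le>n. i)"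
proof -
  have "2 * (Suc n * Suc n + (\<Sum>i\<le>n. i)) = Suc n * (3 * n + 2)"
    by (induction n) (auto simp: algebra_simps)
  then have "2 * int (Suc n * Suc n + (\<Sum>i\<le>n. i)) = int (Suc n) * int (3 * n + 2)"
    by (metis of_nat_mult of_nat_numeral)
  also have "\<dots> = 2 * pent (- int (Suc n))"
    unfolding two_pent by (simp add: algebra_simps)
  finally have "int (Suc n * Suc n + (\<Sum>i\<le>n. i)) = pent (- int (Suc n))"
    by (simp only: mult_cancel_left) simp
  then show ?thesis
    by (metis nat_int)
qed

section \<open>Shanks' identity and the pentagonal number theorem\<close>

text \<open>The summand of Shanks' identity; the triangular number stays a sum, so that no division
  enters the exponent.\<close>

definition shanks_term :: "'a::comm_ring_1 \<Rightarrow> nat \<Rightarrow> nat \<Rightarrow> 'a" where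
  "shanks_term q n k = (-1) ^ k * (\<Prod>j\<in>{k<..n}. 1 - q ^ j) * q ^ (k * n + (\<Sum>i\<le>k. i))"

text \<open>Measures how Shanks' sum changes from \<open>n\<close> to \<open>Suc n\<close>. Only
  \<open>j = n\<close> is wanted, where the product is empty and a single monomial remains; a
  general \<open>j\<close> lets the induction run over partial sums.\<close>

lemma shanks_term_telescope:
  assumes "j \<le> n"
  shows "(\<Sum>k\<le>j. shanks_term q (Suc n) k - shanks_term q n k) =
    (-1) ^ Suc j * (\<Prod>i\<in>{j<..n}. 1 - q ^ i) * q ^ (Suc j * Suc n + (\<Sum>i\<le>j. i))"
  using assms
proof (induction j)
  case 0
  have "{0<..Suc n} = insert (Suc n) {0<..n}"
    by auto
  then show ?case
    by (simp add: shanks_term_def algebra_simps)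
next
  case (Suc j)
  define P where "P = (\<Prod>i\<in>{Suc j<..n}. 1 - q ^ i)"
  define t where "t = (\<Sum>i\<le>j. i)"
  have "{j<..n} = insert (Suc j) {Suc j<..n}" "{Suc j<..Suc n} = insert (Suc n) {Suc j<..n}"
    using Suc.prems by auto
  then have P: "(\<Prod>i\<in>{j<..n}. 1 - q ^ i) = (1 - q ^ Suc j) * P"
    "(\<Prod>i\<in>{Suc j<..Suc n}. 1 - q ^ i) = (1 - q ^ Suc n) * P"
    by (simp_all add: P_def)
  \<comment> \<open>All powers become monomials in \<open>Q\<close>, \<open>a\<close>,
    \<open>b\<close>. After the common factor \<open>(-1) ^ Suc j * P * Q * a\<close> is taken out,
    the step is the identity \<open>(1 - a) + (1 - b) * a - 1 = - a * b\<close>.\<close>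
  define Q where "Q = q ^ (Suc j * n + t)"
  define a where "a = q ^ Suc j"
  define b where "b = q ^ Suc n"
  have e: "q ^ (Suc j * Suc n + t) = Q * a" "q ^ (Suc j * n + (t + Suc j)) = Q * a"
    "q ^ (Suc j * Suc n + (t + Suc j)) = Q * a * a"
    "q ^ (Suc (Suc j) * Suc n + (t + Suc j)) = Q * a * a * b"
    unfolding Q_def a_def b_def power_add[symmetric]
    by (rule arg_cong[where f = "(^) q"]; simp add: algebra_simps)+
  show ?case
    using Suc.IH Suc.prems unfolding sum.atMost_Suc shanks_term_def P P_def[symmetric]
      t_def[symmetric] e a_def[symmetric] b_def[symmetric]
    by (simp add: algebra_simps)
qed

text \<open>Passing from \<open>n\<close> to \<open>Suc n\<close> adds two monomials: the telescoped
  differences give the one for \<open>m = - Suc n\<close>, and the new last summand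
  \<open>k = Suc n\<close> gives the one for \<open>m = Suc n\<close>.\<close>

theorem shanks_identity:
  "(\<Sum>k\<le>n. shanks_term q n k) =
    (\<Sum>m\<in>{- int n..int n}. (-1) ^ nat \<bar>m\<bar> * q ^ nat (pent m))"
proof (induction n)
  case 0
  then show ?case
    by (simp add: shanks_term_def pent_def)
next
  case (Suc n)
  have "(\<Sum>k\<le>Suc n. shanks_term q (Suc n) k) = (\<Sum>k\<le>n. shanks_term q n k) +
      (\<Sum>k\<le>n. shanks_term q (Suc n) k - shanks_term q n k) + shanks_term q (Suc n) (Suc n)"
    by (simp add: sum_subtractf)
  also have "(\<Sum>k\<le>n. shanks_term q (Suc n) k - shanks_term q n k) =
      (-1) ^ Suc n * q ^ nat (pent (- int (Suc n)))"
    unfolding shanks_term_telescope[OF order_refl] nat_pent_uminus_Suc by simp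
  also have "shanks_term q (Suc n) (Suc n) = (-1) ^ Suc n * q ^ nat (pent (int (Suc n)))"
    unfolding shanks_term_def nat_pent_of_nat by simp
  finally have step: "(\<Sum>k\<le>Suc n. shanks_term q (Suc n) k) =
      (\<Sum>m\<in>{- int n..int n}. (-1) ^ nat \<bar>m\<bar> * q ^ nat (pent m)) +
      (-1) ^ Suc n * q ^ nat (pent (- int (Suc n))) +
      (-1) ^ Suc n * q ^ nat (pent (int (Suc n)))"
    unfolding Suc.IH .
  have interval: "{- int (Suc n)..int (Suc n)} =
      insert (int (Suc n)) (insert (- int (Suc n)) {- int n..int n})"
    by auto
  have "nat \<bar>- int (Suc n)\<bar> = Suc n" "nat \<bar>int (Suc n)\<bar> = Suc n"
    "- int (Suc n) \<notin> {- int n..int n}"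
    "int (Suc n) \<notin> insert (- int (Suc n)) {- int n..int n}"
    by auto
  then show ?case
    unfolding step interval by (simp only: sum.insert finite_insert finite_atLeastAtMost_int not_False_eq_True add_ac)
qed

lemma fps_nth_euler_product:
  fixes n :: nat
  shows "(\<Prod>j\<in>{0<..n}. 1 - fps_X ^ j :: int fps) $ n =
    (\<Sum>m\<in>{- int n..int n}. if int n = pent m then (-1) ^ nat \<bar>m\<bar> else 0)"
proof -
  have high: "shanks_term (fps_X :: int fps) n k $ n = 0" if "k > 0" for k
  proof -
    have "k * n \<ge> n"
      using that by simp
    moreover have "(\<Sum>i\<le>k. i) \<ge> k"
      by (rule member_le_sum) auto
    ultimately have "n < k * n + (\<Sum>i\<le>k. i)"
      using that by linarith
    then show ?thesis
      by (simp add: shanks_term_def fps_X_power_mult_right_nth)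
  qed
  have "(\<Prod>j\<in>{0<..n}. 1 - fps_X ^ j :: int fps) $ n = shanks_term fps_X n 0 $ n"
    by (simp add: shanks_term_def)
  also have "\<dots> = (\<Sum>k\<le>n. shanks_term (fps_X :: int fps) n k) $ n"
    unfolding fps_sum_nth using high by (subst sum.remove[of _ 0]) (auto intro!: sum.neutral)
  also have "\<dots> = (\<Sum>m\<in>{- int n..int n}. ((-1) ^ nat \<bar>m\<bar> * fps_X ^ nat (pent m) :: int fps) $ n)"
    unfolding shanks_identity fps_sum_nth ..
  also have "\<dots> = (\<Sum>m\<in>{- int n..int n}. if int n = pent m then (-1) ^ nat \<bar>m\<bar> else 0)"
  proof (rule sum.cong[OF refl])
    fix m
    \<comment> \<open>Needs \<open>pent m\<close> to be nonnegative, as \<open>nat\<close> sends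
      negative values to 0.\<close>
    have "n = nat (pent m) \<longleftrightarrow> int n = pent m"
      using abs_le_pent[of m] by linarith
    then show "((-1) ^ nat \<bar>m\<bar> * fps_X ^ nat (pent m) :: int fps) $ n =
        (if int n = pent m then (-1) ^ nat \<bar>m\<bar> else 0)"
      by (cases "even (nat \<bar>m\<bar>)") (simp_all add: fps_X_power_iff)
  qed
  finally show ?thesis .
qed

section \<open>Signed generating functions of sets of partitions\<close>

definition partitions_in :: "nat set \<Rightarrow> nat multiset set" where
  "partitions_in A = {\<mu>. set_mset \<mu> \<subseteq> A}"

definition strict_partitions_in :: "nat set \<Rightarrow> nat multiset set" where
  "strict_partitions_in A = {\<mu> \<in> partitions_in A. distinct_parts \<mu>}"

definition signed_gf :: "nat multiset set \<Rightarrow> int fps" where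
  "signed_gf S = Abs_fps (\<lambda>n. \<Sum>\<mu> | \<mu> \<in> S \<and> \<Sum>\<^sub># \<mu> = n. (-1) ^ size \<mu>)"

text \<open>A part 0 could be repeated without changing the sum. Finiteness matters in
  \<open>signed_gf\<close>, where a sum over an infinite set would default to 0.\<close>

lemma finite_partitions_in_sum:
  assumes "0 \<notin> A" "S \<subseteq> partitions_in A"
  shows "finite {\<mu> \<in> S. \<Sum>\<^sub># \<mu> = n}"
  by (rule finite_subset[OF _ finite_partition_of_le[of n]])
    (use assms in \<open>auto simp: partitions_in_def partition_of_def\<close>)

lemma signed_gf_Un_disjoint:
  assumes "0 \<notin> A" "S \<union> T \<subseteq> partitions_in A" "S \<inter> T = {}"
  shows "signed_gf (S \<union> T) = signed_gf S + signed_gf T"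
proof (rule fps_ext)
  fix n
  have "{\<mu> \<in> S \<union> T. \<Sum>\<^sub># \<mu> = n} = {\<mu> \<in> S. \<Sum>\<^sub># \<mu> = n} \<union> {\<mu> \<in> T. \<Sum>\<^sub># \<mu> = n}"
    by auto
  then show "signed_gf (S \<union> T) $ n = (signed_gf S + signed_gf T) $ n"
    using assms by (auto simp: signed_gf_def intro!: sum.union_disjoint finite_partitions_in_sum)
qed

text \<open>An extra part \<open>k\<close> raises the sum by \<open>k\<close> and flips the sign,
  and \<open>add_mset k\<close> is injective.\<close>

lemma signed_gf_add_mset_image: "signed_gf (add_mset k ` S) = - (fps_X ^ k * signed_gf S)"
proof (rule fps_ext)
  fix n
  show "signed_gf (add_mset k ` S) $ n = (- (fps_X ^ k * signed_gf S)) $ n"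
  proof (cases "n < k")
    case True
    then have "{\<mu>. \<mu> \<in> add_mset k ` S \<and> \<Sum>\<^sub># \<mu> = n} = {}"
      by auto
    then have "signed_gf (add_mset k ` S) $ n = 0"
      unfolding signed_gf_def fps_nth_Abs_fps by (simp only: sum.empty)
    then show ?thesis
      using True by (simp add: fps_X_power_mult_nth)
  next
    case False
    then have "{\<mu> \<in> add_mset k ` S. \<Sum>\<^sub># \<mu> = n} = add_mset k ` {\<mu> \<in> S. \<Sum>\<^sub># \<mu> = n - k}"
      by auto
    then show ?thesis
      using False
      by (simp add: signed_gf_def fps_X_power_mult_nth sum.reindex inj_on_def sum_negf)
  qed
qed

lemma signed_gf_singleton_empty: "signed_gf {{#}} = 1"
proof (rule fps_ext)
  fix n :: nat
  have "{\<mu>. \<mu> = {#} \<and> \<Sum>\<^sub># \<mu> = n} = (if n = 0 then {{#}} else {})"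
    by auto
  then show "signed_gf {{#}} $ n = 1 $ n"
    by (simp add: signed_gf_def)
qed

text \<open>Phrased as a product equal to 1, which avoids inverses of power series.\<close>

lemma signed_gf_partitions_in:
  assumes "finite A" "0 \<notin> A"
  shows "signed_gf (partitions_in A) * (\<Prod>k\<in>A. 1 + fps_X ^ k) = 1"
  using assms
proof (induction A rule: finite_induct)
  case empty
  then show ?case
    by (simp add: partitions_in_def signed_gf_singleton_empty)
next
  case (insert k A)
  \<comment> \<open>Since \<open>k\<close> may repeat, removing one copy stays in the same set. With
    F and G the series for \<open>A\<close> and \<open>insert k A\<close>, this gives
    \<open>G = F - fps_X ^ k * G\<close>.\<close>
  have split: "partitions_in (insert k A) =
      partitions_in A \<union> add_mset k ` partitions_in (insert k A)"
  proof (intro equalityI subsetI)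
    fix \<mu> assume \<mu>: "\<mu> \<in> partitions_in (insert k A)"
    show "\<mu> \<in> partitions_in A \<union> add_mset k ` partitions_in (insert k A)"
    proof (cases "k \<in># \<mu>")
      case True
      then have "\<mu> = add_mset k (\<mu> - {#k#})"
        by simp
      moreover have "\<mu> - {#k#} \<in> partitions_in (insert k A)"
        using \<mu> by (auto simp: partitions_in_def dest: in_diffD)
      ultimately show ?thesis
        by blast
    next
      case False
      then show ?thesis
        using \<mu> by (auto simp: partitions_in_def)
    qed
  qed (auto simp: partitions_in_def)
  have "signed_gf (partitions_in (insert k A)) = signed_gf (partitions_in A) +
      signed_gf (add_mset k ` partitions_in (insert k A))"
    by (subst split, rule signed_gf_Un_disjoint[of "insert k A"])
      (use insert in \<open>auto simp: partitions_in_def\<close>)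
  then have "signed_gf (partitions_in (insert k A)) * (1 + fps_X ^ k) = signed_gf (partitions_in A)"
    by (simp add: signed_gf_add_mset_image algebra_simps)
  then show ?case
    using insert by (simp add: mult.assoc[symmetric])
qed

lemma signed_gf_strict_partitions_in:
  assumes "finite A" "0 \<notin> A"
  shows "signed_gf (strict_partitions_in A) = (\<Prod>k\<in>A. 1 - fps_X ^ k)"
  using assms
proof (induction A rule: finite_induct)
  case empty
  have "strict_partitions_in {} = {{#}}"
    by (auto simp: strict_partitions_in_def partitions_in_def distinct_parts_def)
  then show ?case
    by (simp add: signed_gf_singleton_empty)
next
  case (insert k A)
  \<comment> \<open>Here \<open>k\<close> occurs at most once, so removing it leads back to
    \<open>A\<close>, and the old series is multiplied by \<open>1 - fps_X ^ k\<close>.\<close>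
  have split: "strict_partitions_in (insert k A) =
      strict_partitions_in A \<union> add_mset k ` strict_partitions_in A"
  proof (intro equalityI subsetI)
    fix \<mu> assume \<mu>: "\<mu> \<in> strict_partitions_in (insert k A)"
    show "\<mu> \<in> strict_partitions_in A \<union> add_mset k ` strict_partitions_in A"
    proof (cases "k \<in># \<mu>")
      case True
      then obtain \<nu> where \<nu>: "\<mu> = add_mset k \<nu>"
        by (metis insert_DiffM)
      have cnt: "count (add_mset k \<nu>) j \<le> 1" for j
        using \<mu> by (simp add: \<nu> strict_partitions_in_def distinct_parts_def)
      have "k \<notin># \<nu>"
        using cnt[of k] by (simp add: not_in_iff)
      moreover have "count \<nu> j \<le> 1" for j
        using cnt[of j] by (simp split: if_splits)
      ultimately have "\<nu> \<in> strict_partitions_in A"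
        using \<mu> by (auto simp: \<nu> strict_partitions_in_def partitions_in_def distinct_parts_def)
      then show ?thesis
        by (simp add: \<nu>)
    next
      case False
      then show ?thesis
        using \<mu> by (auto simp: strict_partitions_in_def partitions_in_def)
    qed
  next
    fix \<mu> assume "\<mu> \<in> strict_partitions_in A \<union> add_mset k ` strict_partitions_in A"
    then show "\<mu> \<in> strict_partitions_in (insert k A)"
    proof
      assume "\<mu> \<in> add_mset k ` strict_partitions_in A"
      then obtain \<nu> where \<nu>: "\<mu> = add_mset k \<nu>" "\<nu> \<in> strict_partitions_in A"
        by blast
      then have "k \<notin># \<nu>"
        using insert.hyps by (auto simp: strict_partitions_in_def partitions_in_def)
      then show ?thesis
        using \<nu> by (auto simp: strict_partitions_in_def partitions_in_def distinct_parts_def not_in_iff)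
    qed (auto simp: strict_partitions_in_def partitions_in_def)
  qed
  have "signed_gf (strict_partitions_in (insert k A)) = signed_gf (strict_partitions_in A) +
      signed_gf (add_mset k ` strict_partitions_in A)"
    by (subst split, rule signed_gf_Un_disjoint[of "insert k A"])
      (use insert in \<open>auto simp: strict_partitions_in_def partitions_in_def\<close>)
  then show ?case
    using insert by (simp add: signed_gf_add_mset_image algebra_simps)
qed

section \<open>Overpartitions with only even parts overlined\<close>

lemma sum_minus_one_power_eq_card_diff:
  assumes "finite S"
  shows "(\<Sum>x\<in>S. (-1 :: int) ^ f x) = int (card {x \<in> S. even (f x)}) - int (card {x \<in> S. odd (f x)})"
proof -
  have "(\<Sum>x\<in>S. (-1 :: int) ^ f x) =
      (\<Sum>x\<in>{x \<in> S. even (f x)}. (-1) ^ f x) + (\<Sum>x\<in>{x \<in> S. odd (f x)}. (-1) ^ f x)"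
    using assms by (subst sum.union_disjoint[symmetric]) (auto intro!: sum.cong)
  then show ?thesis
    by simp
qed

lemma mset_le_sum_mset:
  fixes \<mu> :: "nat multiset"
  assumes "x \<in># \<mu>"
  shows "x \<le> \<Sum>\<^sub># \<mu>"
  using assms by (metis insert_DiffM le_add1 sum_mset.add_mset)

lemma mem_overpartitions_iff:
  "(\<mu>, \<nu>) \<in> overpartitions n \<longleftrightarrow>
    distinct_parts \<nu> \<and> 0 \<notin># \<mu> \<and> 0 \<notin># \<nu> \<and> \<Sum>\<^sub># \<mu> + \<Sum>\<^sub># \<nu> = n"
  by (auto simp: overpartitions_def partition_of_def)

text \<open>Splitting by the sum \<open>i\<close> of the non-overlined parts prepares a Cauchy
  product. Overlined parts are allowed up to \<open>2 * n\<close>, although none above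
  \<open>n\<close> can occur, so that both families of parts are indexed by the same
  \<open>{0<..n}\<close> and their factors can be paired.\<close>

lemma even_overpartitions_eq:
  "{\<pi> \<in> overpartitions n. only_even_overlined \<pi>} =
    (\<Union>i\<in>{0..n}. {\<mu> \<in> partitions_in {0<..n}. \<Sum>\<^sub># \<mu> = i} \<times>
       {\<nu> \<in> strict_partitions_in ((*) 2 ` {0<..n}). \<Sum>\<^sub># \<nu> = n - i})"
  (is "?L = ?R")
proof (intro equalityI subsetI)
  fix \<pi> assume "\<pi> \<in> ?L"
  then obtain \<mu> \<nu> where \<pi>: "\<pi> = (\<mu>, \<nu>)" and d: "distinct_parts \<nu>"
    and z: "0 \<notin># \<mu>" "0 \<notin># \<nu>" and s: "\<Sum>\<^sub># \<mu> + \<Sum>\<^sub># \<nu> = n" and ev: "\<forall>k\<in>#\<nu>. even k"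
    by (cases \<pi>) (auto simp: mem_overpartitions_iff only_even_overlined_def)
  have "x \<in> {0<..n}" if "x \<in># \<mu>" for x
    using mset_le_sum_mset[OF that] z that s by (cases "x = 0") auto
  moreover have "x \<in> (*) 2 ` {0<..n}" if "x \<in># \<nu>" for x
  proof -
    have "even x"
      using ev that by simp
    then obtain y where y: "x = 2 * y"
      by (rule evenE)
    moreover have "y \<in> {0<..n}"
      using mset_le_sum_mset[OF that] z that s y by (cases "y = 0") auto
    ultimately show ?thesis
      by (rule image_eqI)
  qed
  ultimately show "\<pi> \<in> ?R"
    using s d by (auto simp: \<pi> subset_eq partitions_in_def strict_partitions_in_def)
next
  fix \<pi> assume "\<pi> \<in> ?R"
  then obtain \<mu> \<nu> where \<pi>: "\<pi> = (\<mu>, \<nu>)" and d: "distinct_parts \<nu>"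
    and s: "\<Sum>\<^sub># \<mu> + \<Sum>\<^sub># \<nu> = n"
    and \<mu>: "set_mset \<mu> \<subseteq> {0<..n}" and \<nu>: "set_mset \<nu> \<subseteq> (*) 2 ` {0<..n}"
    by (auto simp: partitions_in_def strict_partitions_in_def)
  have "0 \<notin># \<mu>" "0 \<notin># \<nu>" "\<forall>k\<in>#\<nu>. even k"
    using \<mu> \<nu> by (auto dest!: subsetD)
  then show "\<pi> \<in> ?L"
    using d s by (simp add: \<pi> mem_overpartitions_iff only_even_overlined_def)
qed

lemma d2e_minus_d2o_eq_euler_product:
  "int (d2e n) - int (d2o n) = (\<Prod>j\<in>{0<..n}. 1 - fps_X ^ j :: int fps) $ n"
proof -
  let ?A = "{0<..n}" and ?B = "(*) (2::nat) ` {0<..n}"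
  let ?U = "\<lambda>i. {\<mu> \<in> partitions_in ?A. \<Sum>\<^sub># \<mu> = i}"
  let ?V = "\<lambda>i. {\<nu> \<in> strict_partitions_in ?B. \<Sum>\<^sub># \<nu> = i}"
  have fin: "finite (?U i)" "finite (?V i)" for i
    by (rule finite_partitions_in_sum[of ?A], auto)
      (rule finite_partitions_in_sum[of ?B], auto simp: strict_partitions_in_def)
  have "finite {\<pi> \<in> overpartitions n. only_even_overlined \<pi>}"
    using finite_overpartitions by simp
  then have "int (d2e n) - int (d2o n) =
      (\<Sum>\<pi> | \<pi> \<in> overpartitions n \<and> only_even_overlined \<pi>. (-1) ^ num_parts \<pi>)"
    by (simp add: sum_minus_one_power_eq_card_diff d2e_def d2o_def conj_assoc)
  also have "\<dots> = (\<Sum>i\<in>{0..n}. \<Sum>\<pi>\<in>?U i \<times> ?V (n - i). (-1) ^ num_parts \<pi>)"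
    unfolding even_overpartitions_eq
    \<comment> \<open>The blocks are disjoint because \<open>i\<close> is recovered as the sum of
      the first component.\<close>
    by (rule sum.UNION_disjoint) (use fin in auto)
  also have "\<dots> = (\<Sum>i\<in>{0..n}. signed_gf (partitions_in ?A) $ i *
      signed_gf (strict_partitions_in ?B) $ (n - i))"
    \<comment> \<open>The sign splits over the pair because \<open>num_parts\<close> adds the two
      sizes.\<close>
    by (simp add: signed_gf_def sum_product sum.cartesian_product num_parts_def power_add
        split_def)
  also have "\<dots> = (signed_gf (partitions_in ?A) * signed_gf (strict_partitions_in ?B)) $ n"
    by (simp add: fps_mult_nth)
  also have "signed_gf (strict_partitions_in ?B) =
      (\<Prod>k\<in>?A. 1 + fps_X ^ k) * (\<Prod>k\<in>?A. 1 - fps_X ^ k)"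
  proof -
    have "signed_gf (strict_partitions_in ?B) = (\<Prod>k\<in>?A. 1 - fps_X ^ (2 * k))"
      by (subst signed_gf_strict_partitions_in) (auto simp: prod.reindex inj_on_def)
    also have "\<dots> = (\<Prod>k\<in>?A. (1 + fps_X ^ k) * (1 - fps_X ^ k))"
      \<comment> \<open>A difference of squares; the factors \<open>1 + fps_X ^ k\<close> then
        cancel against the series of the non-overlined parts.\<close>
      by (rule prod.cong) (simp_all add: algebra_simps flip: power_add mult_2_right)
    finally show ?thesis
      by (simp add: prod.distrib)
  qed
  also have "signed_gf (partitions_in ?A) * \<dots> = (\<Prod>k\<in>?A. 1 - fps_X ^ k)"
    by (simp add: mult.assoc[symmetric] signed_gf_partitions_in)
  finally show ?thesis .
qed

theorem theorem5:
  fixes n :: nat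
  shows "(\<forall>m::int. int n = pent m \<longrightarrow> int (d2e n) - int (d2o n) = (-1) ^ nat \<bar>m\<bar>) \<and>
         ((\<nexists>m::int. int n = pent m) \<longrightarrow> int (d2e n) - int (d2o n) = 0)"
proof (intro conjI allI impI)
  fix m :: int assume m: "int n = pent m"
  then have "m \<in> {- int n..int n}"
    using abs_le_pent[of m] by auto
  \<comment> \<open>By injectivity the sum over the range collapses to its summand at
    \<open>m\<close>.\<close>
  moreover have "int n = pent k \<longleftrightarrow> k = m" for k
    using m inj_pent by (auto simp: inj_def)
  ultimately show "int (d2e n) - int (d2o n) = (-1) ^ nat \<bar>m\<bar>"
    by (simp add: d2e_minus_d2o_eq_euler_product fps_nth_euler_product)
next
  assume "\<nexists>m::int. int n = pent m"
  then show "int (d2e n) - int (d2o n) = 0"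
    by (simp add: d2e_minus_d2o_eq_euler_product fps_nth_euler_product)
qed

end
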